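(* Let $\lambda$ be a nonzero real number and let $(a_n(\lambda))_{n\ge0}$ be any sequence of real numbers. Define the degenerate B-algorithm matrix $(a_{n,m}(\lambda))_{n,m\ge0}$ by $a_{0,m}(\lambda)=a_m(\lambda)$ for $m\ge0$ and \[ a_{n,m}(\lambda)=\big(m-(n-1)\lambda\big)a_{n-1,m}(\lambda)-(m+1)a_{n-1,m+1}(\lambda),\qquad n\ge1,\ m\ge0. \] Then for every integer $n\ge0$, \[ a_{n,0}(\lambda)=\sum_{k=0}^{n}(-1)^{k}k!\,{n \brace k}_{\lambda}\,a_{0,k}(\lambda). \]
   Context: For $n\ge0$ set $(x)_{0,\lambda}=1$, $(x)_{n,\lambda}=x(x-\lambda)\cdots(x-(n-1)\lambda)$ for $n\ge1$, and $(x)_0=1$, $(x)_n=x(x-1)\cdots(x-n+1)$ for $n\ge1$. The degenerate Stirling numbers of the second kind ${n \brace k}_{\lambda}$ are defined by $(x)_{n,\lambda}=\sum_{k=0}^{n}{n \brace k}_{\lambda}(x)_{k}$ for $n\ge0$. *)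

theory Defs
  imports Complex_Main
begin

definition falling_factorial :: "real \<Rightarrow> nat \<Rightarrow> real" where
  "falling_factorial x n = (\<Prod>i<n. x - real i)"

definition degenerate_falling_factorial :: "real \<Rightarrow> real \<Rightarrow> nat \<Rightarrow> real" where
  "degenerate_falling_factorial lam x n = (\<Prod>i<n. x - real i * lam)"

text \<open>The defining identity determines the coefficients only for \<open>k \<le> n\<close>. Row \<open>n\<close> is extended by
  zero to \<open>k > n\<close>, which makes it unique as a function on the natural numbers; existence and
  uniqueness are proved in \<open>degenerate_Stirling2_row_ex1\<close> below.\<close>

definition is_degenerate_Stirling2_row :: "real \<Rightarrow> nat \<Rightarrow> (nat \<Rightarrow> real) \<Rightarrow> bool" where
  "is_degenerate_Stirling2_row lam n S \<longleftrightarrow>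
     (\<forall>x. degenerate_falling_factorial lam x n = (\<Sum>k\<le>n. S k * falling_factorial x k)) \<and>
     (\<forall>k>n. S k = 0)"

definition degenerate_Stirling2 :: "real \<Rightarrow> nat \<Rightarrow> nat \<Rightarrow> real" where
  "degenerate_Stirling2 lam n = (THE S. is_degenerate_Stirling2_row lam n S)"

text \<open>\<open>B_matrix lam a n m\<close> is the entry \<open>a\<^sub>n\<^sub>,\<^sub>m(lam)\<close> with initial row \<open>a\<close>; the recurrence is stated with
  \<open>Suc n\<close> in the place of \<open>n \<ge> 1\<close>, so that \<open>n - 1\<close> becomes \<open>n\<close>.\<close>

primrec B_matrix :: "real \<Rightarrow> (nat \<Rightarrow> real) \<Rightarrow> nat \<Rightarrow> nat \<Rightarrow> real" where
  "B_matrix lam a 0 = a"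
| "B_matrix lam a (Suc n) =
     (\<lambda>m. (real m - real n * lam) * B_matrix lam a n m - (real m + 1) * B_matrix lam a n (m + 1))"

lemma falling_factorial_Suc:
  "falling_factorial x (Suc k) = falling_factorial x k * (x - real k)"
  by (simp add: falling_factorial_def)

lemma falling_factorial_of_nat_eq_0:
  assumes "m < k"
  shows "falling_factorial (real m) k = 0"
  using assms by (auto simp: falling_factorial_def)

lemma falling_factorial_of_nat_self_nonzero: "falling_factorial (real m) m \<noteq> 0"
  by (auto simp: falling_factorial_def)

lemma is_degenerate_Stirling2_row_exists: "\<exists>S. is_degenerate_Stirling2_row lam n S"
proof (induction n)
  case 0
  have "is_degenerate_Stirling2_row lam 0 (\<lambda>k. if k = 0 then 1 else 0)"
    by (simp add: is_degenerate_Stirling2_row_def degenerate_falling_factorial_def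
        falling_factorial_def)
  then show ?case by blast
next
  case (Suc n)
  then obtain S where S:
    "\<And>x. degenerate_falling_factorial lam x n = (\<Sum>k\<le>n. S k * falling_factorial x k)"
    and S0: "\<And>k. k > n \<Longrightarrow> S k = 0"
    unfolding is_degenerate_Stirling2_row_def by blast
  define T where
    "T k = (if k = 0 then 0 else S (k - 1)) + (real k - real n * lam) * S k" for k
  have "degenerate_falling_factorial lam x (Suc n) = (\<Sum>k\<le>Suc n. T k * falling_factorial x k)" for x
  proof -
    have "degenerate_falling_factorial lam x (Suc n) =
        (\<Sum>k\<le>n. S k * falling_factorial x k) * (x - real n * lam)"
      using S[of x] by (simp add: degenerate_falling_factorial_def)
    also have "\<dots> = (\<Sum>k\<le>n. S k * falling_factorial x (Suc k)) +
        (\<Sum>k\<le>n. (real k - real n * lam) * S k * falling_factorial x k)"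
      unfolding sum_distrib_right sum.distrib[symmetric]
      by (intro sum.cong refl) (simp add: falling_factorial_Suc algebra_simps)
    also have "(\<Sum>k\<le>n. S k * falling_factorial x (Suc k)) =
        (\<Sum>k\<le>Suc n. (if k = 0 then 0 else S (k - 1)) * falling_factorial x k)"
      by (subst sum.atMost_Suc_shift) simp
    also have "(\<Sum>k\<le>n. (real k - real n * lam) * S k * falling_factorial x k) =
        (\<Sum>k\<le>Suc n. (real k - real n * lam) * S k * falling_factorial x k)"
      using S0[of "Suc n"] by simp
    finally show ?thesis
      unfolding T_def sum.distrib[symmetric] distrib_right .
  qed
  moreover have "T k = 0" if "k > Suc n" for k
    using that S0 by (simp add: T_def)
  ultimately show ?case
    unfolding is_degenerate_Stirling2_row_def by blast
qed

lemma is_degenerate_Stirling2_row_unique: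
  assumes S: "is_degenerate_Stirling2_row lam n S" and T: "is_degenerate_Stirling2_row lam n T"
  shows "S = T"
proof
  fix k
  show "S k = T k"
  proof (induction k rule: less_induct)
    case (less m)
    show ?case
    proof (cases "m \<le> n")
      case True
      have "0 = (\<Sum>k\<le>n. S k * falling_factorial (real m) k) -
          (\<Sum>k\<le>n. T k * falling_factorial (real m) k)"
        using S T by (simp add: is_degenerate_Stirling2_row_def)
      also have "\<dots> = (\<Sum>k\<le>n. (S k - T k) * falling_factorial (real m) k)"
        by (simp add: sum_subtractf left_diff_distrib)
      also have "\<dots> = (\<Sum>k\<in>{m}. (S k - T k) * falling_factorial (real m) k)"
      proof (rule sum.mono_neutral_right)
        show "\<forall>k\<in>{..n} - {m}. (S k - T k) * falling_factorial (real m) k = 0"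
          using less falling_factorial_of_nat_eq_0[of m] by (auto simp: neq_iff)
      qed (use True in auto)
      finally show ?thesis
        using falling_factorial_of_nat_self_nonzero[of m] by simp
    next
      case False
      then show ?thesis
        using S T by (simp add: is_degenerate_Stirling2_row_def)
    qed
  qed
qed

lemma degenerate_Stirling2_row_ex1: "\<exists>!S. is_degenerate_Stirling2_row lam n S"
  using is_degenerate_Stirling2_row_exists is_degenerate_Stirling2_row_unique by blast

lemma degenerate_Stirling2_row: "is_degenerate_Stirling2_row lam n (degenerate_Stirling2 lam n)"
  unfolding degenerate_Stirling2_def by (rule theI'[OF degenerate_Stirling2_row_ex1])

end

theory Submission
  imports Defs
begin

text \<open>Put \<open>(\<theta>\<^sub>c b)\<^sub>m = (m - c) b\<^sub>m - (m + 1) b\<^sub>m\<^sub>+\<^sub>1\<close>; row \<open>n\<close> of the matrix is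
  \<open>\<theta>\<^bsub>(n-1)\<lambda>\<^esub> \<dots> \<theta>\<^bsub>\<lambda>\<^esub> \<theta>\<^sub>0 a\<close>. These operators commute, so the last of them may be applied first,
  directly to \<open>a\<close>. The functionals \<open>\<phi>\<^sub>k b = (-1)\<^sup>k k! b\<^sub>k\<close> satisfy
  \<open>\<phi>\<^sub>k (\<theta>\<^sub>c b) = \<phi>\<^sub>k\<^sub>+\<^sub>1 b + (k - c) \<phi>\<^sub>k b\<close>, which is the rule
  \<open>(x - c) (x)\<^sub>k = (x)\<^sub>k\<^sub>+\<^sub>1 + (k - c) (x)\<^sub>k\<close>. Hence \<open>\<phi>\<^sub>0\<close> of row \<open>n\<close> expands in the \<open>\<phi>\<^sub>k a\<close> with the
  coefficients with which \<open>(x)\<^bsub>n,\<lambda>\<^esub>\<close> expands in the \<open>(x)\<^sub>k\<close>.\<close>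

definition B_step :: "real \<Rightarrow> (nat \<Rightarrow> real) \<Rightarrow> nat \<Rightarrow> real" where
  "B_step c b m = (real m - c) * b m - (real m + 1) * b (Suc m)"

lemma B_matrix_Suc_B_step: "B_matrix lam a (Suc n) = B_step (real n * lam) (B_matrix lam a n)"
  by (simp add: B_step_def fun_eq_iff)

lemma B_step_commute: "B_step c (B_step d b) = B_step d (B_step c b)"
  by (simp add: B_step_def fun_eq_iff algebra_simps)

lemma B_matrix_B_step: "B_matrix lam (B_step c a) n = B_step c (B_matrix lam a n)"
proof (induction n)
  case (Suc n)
  then show ?case
    unfolding B_matrix_Suc_B_step by (simp add: B_step_commute)
qed simp

text \<open>Multiplication by \<open>x - c\<close>, read on coefficients in the basis
  \<open>falling_factorial x k\<close>.\<close>

definition Stirling2_step :: "real \<Rightarrow> (nat \<Rightarrow> real) \<Rightarrow> nat \<Rightarrow> real" where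
  "Stirling2_step c S k = (if k = 0 then 0 else S (k - 1)) + (real k - c) * S k"

text \<open>An index shift moves the step from the coefficients to \<open>f\<close>. The family
  \<open>f\<close> is arbitrary so as to cover both the falling factorials and the values \<phi> of
  the initial row.\<close>

lemma sum_Stirling2_step:
  assumes "S (Suc n) = 0"
  shows "(\<Sum>k\<le>Suc n. Stirling2_step c S k * f k) =
    (\<Sum>k\<le>n. S k * (f (Suc k) + (real k - c) * f k))"
proof -
  have "(\<Sum>k\<le>Suc n. Stirling2_step c S k * f k) =
      (\<Sum>k\<le>Suc n. (if k = 0 then 0 else S (k - 1)) * f k) +
      (\<Sum>k\<le>Suc n. (real k - c) * S k * f k)"
    unfolding Stirling2_step_def distrib_right sum.distrib ..
  also have "(\<Sum>k\<le>Suc n. (if k = 0 then 0 else S (k - 1)) * f k) = (\<Sum>k\<le>n. S k * f (Suc k))"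
    by (subst sum.atMost_Suc_shift) simp
  also have "(\<Sum>k\<le>Suc n. (real k - c) * S k * f k) = (\<Sum>k\<le>n. (real k - c) * S k * f k)"
    using assms by simp
  finally show ?thesis
    by (simp add: sum.distrib[symmetric] algebra_simps)
qed

lemma degenerate_Stirling2_eq_0: "n < k \<Longrightarrow> degenerate_Stirling2 lam n k = 0"
  using degenerate_Stirling2_row[of lam n] by (simp add: is_degenerate_Stirling2_row_def)

lemma degenerate_Stirling2_Suc:
  "degenerate_Stirling2 lam (Suc n) = Stirling2_step (real n * lam) (degenerate_Stirling2 lam n)"
proof (rule is_degenerate_Stirling2_row_unique[OF degenerate_Stirling2_row])
  let ?S = "degenerate_Stirling2 lam n" and ?c = "real n * lam"
  have "degenerate_falling_factorial lam x (Suc n) =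
      (\<Sum>k\<le>Suc n. Stirling2_step ?c ?S k * falling_factorial x k)" for x
  proof -
    have "degenerate_falling_factorial lam x (Suc n) =
        (\<Sum>k\<le>n. ?S k * falling_factorial x k) * (x - ?c)"
      using degenerate_Stirling2_row[of lam n]
      by (simp add: is_degenerate_Stirling2_row_def degenerate_falling_factorial_def)
    also have "\<dots> = (\<Sum>k\<le>n. ?S k * (falling_factorial x (Suc k) +
        (real k - ?c) * falling_factorial x k))"
      unfolding sum_distrib_right
      by (intro sum.cong refl) (simp add: falling_factorial_Suc algebra_simps)
    also have "\<dots> = (\<Sum>k\<le>Suc n. Stirling2_step ?c ?S k * falling_factorial x k)"
      by (rule sum_Stirling2_step[symmetric]) (simp add: degenerate_Stirling2_eq_0)
    finally show ?thesis .
  qed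
  then show "is_degenerate_Stirling2_row lam (Suc n) (Stirling2_step ?c ?S)"
    by (simp add: is_degenerate_Stirling2_row_def Stirling2_step_def degenerate_Stirling2_eq_0)
qed

lemma degenerate_Stirling2_0_0: "degenerate_Stirling2 lam 0 0 = 1"
  using degenerate_Stirling2_row[of lam 0]
  by (simp add: is_degenerate_Stirling2_row_def degenerate_falling_factorial_def
      falling_factorial_def)

lemma B_matrix_first_column:
  "B_matrix lam a n 0 = (\<Sum>k\<le>n. degenerate_Stirling2 lam n k * ((-1) ^ k * fact k * a k))"
\<comment> \<open>The induction hypothesis is needed for the initial row
  \<open>B_step ?c a\<close>.\<close>
proof (induction n arbitrary: a)
  case 0
  show ?case by (simp add: degenerate_Stirling2_0_0)
next
  case (Suc n)
  let ?S = "degenerate_Stirling2 lam n" and ?c = "real n * lam"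
  let ?\<phi> = "\<lambda>k b. (-1) ^ k * fact k * b k :: real"
  have \<phi>: "?\<phi> k (B_step ?c a) = ?\<phi> (Suc k) a + (real k - ?c) * ?\<phi> k a" for k
    by (simp add: B_step_def algebra_simps)
  have "B_matrix lam a (Suc n) 0 = B_matrix lam (B_step ?c a) n 0"
    unfolding B_matrix_Suc_B_step B_matrix_B_step ..
  also have "\<dots> = (\<Sum>k\<le>n. ?S k * (?\<phi> (Suc k) a + (real k - ?c) * ?\<phi> k a))"
    unfolding Suc.IH \<phi> ..
  also have "\<dots> = (\<Sum>k\<le>Suc n. Stirling2_step ?c ?S k * ?\<phi> k a)"
    by (rule sum_Stirling2_step[symmetric]) (simp add: degenerate_Stirling2_eq_0)
  finally show ?case
    unfolding degenerate_Stirling2_Suc .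
qed

theorem theorem2p3:
  fixes lam :: real and a :: "nat \<Rightarrow> real" and n :: nat
  assumes "lam \<noteq> 0"
  shows "B_matrix lam a n 0 =
    (\<Sum>k=0..n. (-1) ^ k * fact k * degenerate_Stirling2 lam n k * B_matrix lam a 0 k)"
  by (simp add: B_matrix_first_column atLeast0AtMost mult_ac)

end
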